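(* There exists an $\mathcal{A}_{\mathbb{N}}^-$-topological system $(X,(T_g)_{g\in\mathcal{A}_{\mathbb{N}}^-})$ with a dense set of additively minimal points, such that each map $T_g:X\to X$ is open and injective, and with the property that for any finite coloring $\mathbb{N}=C_1\cup\cdots\cup C_r$ there exists an open cover $X=U_1\cup\cdots\cup U_r$ such that for any $k\in\mathbb{N}$, any $g_1,\dots,g_k\in\mathcal{A}_{\mathbb{N}}^-$ and any $t\in\{1,\dots,r\}$, $$\bigcap_{\ell=1}^kT_{g_\ell}(U_t)\neq\varnothing\qquad\Longrightarrow\qquad\mathbb{N}\cap\bigcap_{\ell=1}^kg_\ell(C_t)\neq\varnothing.$$
   Context: $\mathbb{N}=\{1,2,\dots\}$. A finite coloring of $\mathbb{N}$ is a finite partition $\mathbb{N}=C_1\cup\cdots\cup C_r$. $\mathcal{A}_{\mathbb{N}}^-$ is the semigroup, under composition, of all maps $\mathbb{Z}\to\mathbb{Z}$ of the form $x\mapsto ax+b$ with $a\in\mathbb{N}$ and $b\in\mathbb{Z}$; in particular $g(C)\subset\mathbb{Z}$ for $g\in\mathcal{A}_{\mathbb{N}}^-$ and $C\subset\mathbb{N}$. For $u\in\mathbb{Z}$, $A_u\in\mathcal{A}_{\mathbb{N}}^-$ denotes the map $x\mapsto x+u$. For a semigroup $G$, a $G$-topological system is a pair $(X,(T_g)_{g\in G})$ where $X$ is a nonempty compact Hausdorff space (not necessarily metrizable) and $(T_g)_{g\in G}$ is an action of $G$ on $X$ by continuous maps $T_g:X\to X$, i.e. $T_g\circ T_h=T_{gh}$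 for all $g,h\in G$ (the identity element, if any, acting as the identity map). A system is minimal if $X$ contains no proper non-empty closed invariant subset. A point $x\in X$ is a minimal point if its orbit closure $Y=\overline{\{T_gx:g\in G\}}$, with the restricted action, is a minimal system. An $\mathcal{A}_{\mathbb{N}}^-$-topological system induces a $(\mathbb{Z},+)$-topological system $(X,(S_u)_{u\in\mathbb{Z}})$ with $S_u:=T_{A_u}$; a point $x\in X$ is additively minimal if it is a minimal point for $(X,(S_u)_{u\in\mathbb{Z}})$. *)

theory Defs
  imports "HOL-Analysis.Analysis"
begin

locale semigroup_on =
  fixes G :: "'g set" and mul :: "'g \<Rightarrow> 'g \<Rightarrow> 'g"
  assumes mul_closed: "g \<in> G \<Longrightarrow> h \<in> G \<Longrightarrow> mul g h \<in> G"
    and mul_assoc: "g \<in> G \<Longrightarrow> h \<in> G \<Longrightarrow> k \<in> G \<Longrightarrow> mul (mul g h) k = mul g (mul h k)"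

text \<open>The values of \<open>T\<close> outside \<open>G\<close>, and of \<open>T g\<close> outside \<open>topspace X\<close>, are irrelevant.\<close>

locale topological_system = semigroup_on G mul
  for G :: "'g set" and mul :: "'g \<Rightarrow> 'g \<Rightarrow> 'g" +
  fixes X :: "'x topology" and T :: "'g \<Rightarrow> 'x \<Rightarrow> 'x"
  assumes nonempty: "topspace X \<noteq> {}"
    and compact: "compact_space X"
    and Hausdorff: "Hausdorff_space X"
    and continuous: "g \<in> G \<Longrightarrow> continuous_map X X (T g)"
    and action: "g \<in> G \<Longrightarrow> h \<in> G \<Longrightarrow> x \<in> topspace X \<Longrightarrow> T g (T h x) = T (mul g h) x"
    and action_identity:
      "e \<in> G \<Longrightarrow> (\<forall>g\<in>G. mul e g = g \<and> mul g e = g) \<Longrightarrow> x \<in> topspace X \<Longrightarrow> T e x = x"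

definition minimal_system ::
    "'g set \<Rightarrow> ('g \<Rightarrow> 'g \<Rightarrow> 'g) \<Rightarrow> 'x topology \<Rightarrow> ('g \<Rightarrow> 'x \<Rightarrow> 'x) \<Rightarrow> bool" where
  "minimal_system G mul X T \<longleftrightarrow>
     topological_system G mul X T \<and>
     \<not> (\<exists>Y. closedin X Y \<and> Y \<noteq> {} \<and> Y \<noteq> topspace X \<and> (\<forall>g\<in>G. T g ` Y \<subseteq> Y))"

definition orbit_closure ::
    "'g set \<Rightarrow> 'x topology \<Rightarrow> ('g \<Rightarrow> 'x \<Rightarrow> 'x) \<Rightarrow> 'x \<Rightarrow> 'x set" where
  "orbit_closure G X T x = X closure_of {T g x | g. g \<in> G}"

definition minimal_point ::
    "'g set \<Rightarrow> ('g \<Rightarrow> 'g \<Rightarrow> 'g) \<Rightarrow> 'x topology \<Rightarrow> ('g \<Rightarrow> 'x \<Rightarrow> 'x) \<Rightarrow> 'x \<Rightarrow> bool" where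
  "minimal_point G mul X T x \<longleftrightarrow>
     x \<in> topspace X \<and> minimal_system G mul (subtopology X (orbit_closure G X T x)) T"

text \<open>\<open>\<nat> = {1, 2, \<dots>}\<close>, regarded as a subset of \<open>\<int>\<close>.\<close>

definition pos_ints :: "int set" where
  "pos_ints = {1..}"

definition affine_semigroup :: "(int \<Rightarrow> int) set" where
  "affine_semigroup = {\<lambda>x. a * x + b | a b. a \<in> pos_ints}"

definition translation :: "int \<Rightarrow> int \<Rightarrow> int" where
  "translation u = (\<lambda>x. x + u)"

definition additively_minimal ::
    "'x topology \<Rightarrow> ((int \<Rightarrow> int) \<Rightarrow> 'x \<Rightarrow> 'x) \<Rightarrow> 'x \<Rightarrow> bool" where
  "additively_minimal X T x \<longleftrightarrow>
     minimal_point (UNIV :: int set) (+) X (\<lambda>u. T (translation u)) x"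

text \<open>Colour classes are allowed to be empty.\<close>

definition finite_coloring :: "nat \<Rightarrow> (nat \<Rightarrow> int set) \<Rightarrow> bool" where
  "finite_coloring r C \<longleftrightarrow>
     (\<Union>t\<in>{1..r}. C t) = pos_ints \<and> disjoint_family_on C {1..r}"

definition open_cover :: "'x topology \<Rightarrow> nat \<Rightarrow> (nat \<Rightarrow> 'x set) \<Rightarrow> bool" where
  "open_cover X r U \<longleftrightarrow>
     (\<forall>t\<in>{1..r}. openin X (U t)) \<and> (\<Union>t\<in>{1..r}. U t) = topspace X"

text \<open>
  HOL has no existential quantifier over types, so the existence of a compact Hausdorff space has
  to be asserted on a fixed type of points.  This one has the cardinality of the Stone-Cech
  compactification of the integers, whose points are ultrafilters, that is, sets of sets of
  integers.  The topology itself remains existentially quantified.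
\<close>

type_synonym point = "int set set"

end

theory Submission imports Defs begin

text \<open>
  The space is made of ultrafilters on \<open>\<int>\<close>, and \<open>g\<close> acts on an ultrafilter by pushing it forward,
  \<open>push g p = {A. g -` A \<in> p}\<close>.  Only ultrafilters concentrated at plus infinity, that is,
  containing every ray \<open>{n..}\<close>, are admitted: this condition is preserved by all maps
  \<open>x \<mapsto> a x + b\<close> with \<open>a \<ge> 1\<close>, negative translations included, and it puts the set of positive
  integers into every ultrafilter of the space.  A coloring of the positive integers therefore
  induces an open cover by the sets \<open>U t = {p. C t \<in> p}\<close>.  A common point \<open>q\<close> of the images
  \<open>push (g l) ` U t\<close> contains the positive integers and each \<open>g l ` C t\<close>, hence their intersection,
  which is then nonempty.

  To make additively minimal points dense, one passes to the closure of the set of these points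
  among the ultrafilters at infinity.  Injectivity and continuity of \<open>push g\<close> survive the
  restriction; what needs an argument is that this closure is invariant and that \<open>push g\<close> is still
  open on it.  Both follow once \<open>push g p\<close> is known to be additively minimal if and only if \<open>p\<close> is
  (\<open>additively_recurrent_push_iff\<close>): an ultrafilter containing \<open>range g\<close> is a push-forward along \<open>g\<close>,
  so the image of the basic open set given by \<open>A\<close> is then the basic open set given by \<open>g ` A\<close>.

  That equivalence is read off from the description of minimality by uniform recurrence
  (\<open>minimal_point_iff_syndetic_returns\<close>): a point of a compact Hausdorff system of a group is
  minimal exactly when its return times to each of its neighbourhoods form a syndetic set.  Under
  \<open>x \<mapsto> a x + b\<close> return times are multiplied by \<open>a\<close>, which neither creates nor destroys
  syndeticity.  Minimal points exist by Zorn's lemma, and compactness of the space of ultrafilters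
  comes from Tychonoff's theorem.
\<close>

section \<open>Minimal points of topological systems\<close>

lemma closed_invariant_subsystem:
  assumes sys: "topological_system G mul X T"
    and Y: "closedin X Y" "Y \<noteq> {}" "\<And>g. g \<in> G \<Longrightarrow> T g ` Y \<subseteq> Y"
  shows "topological_system G mul (subtopology X Y) T"
proof -
  interpret topological_system G mul X T by fact
  have sub: "Y \<subseteq> topspace X"
    using Y(1) by (rule closedin_subset)
  show ?thesis
  proof (unfold_locales)
    show "topspace (subtopology X Y) \<noteq> {}"
      using sub Y(2) by auto
    show "compact_space (subtopology X Y)"
      using closedin_compact_space[OF compact Y(1)] by (rule compact_space_subtopology)
    show "Hausdorff_space (subtopology X Y)"
      by (rule Hausdorff_space_subtopology[OF Hausdorff])
    show "continuous_map (subtopology X Y) (subtopology X Y) (T g)" if "g \<in> G" for g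
      using continuous[OF that] Y(3)[OF that]
      by (auto simp: continuous_map_in_subtopology intro: continuous_map_from_subtopology)
    show "T g (T h x) = T (mul g h) x"
      if "g \<in> G" "h \<in> G" "x \<in> topspace (subtopology X Y)" for g h x
      using that action by auto
    show "T e x = x"
      if "e \<in> G" "\<forall>g\<in>G. mul e g = g \<and> mul g e = g" "x \<in> topspace (subtopology X Y)" for e x
      using that action_identity by auto
  qed
qed

text \<open>Zorn's lemma is applied to the complements of closed invariant sets, because in a compact
  space the union of a chain of proper open subsets is again proper.\<close>

lemma ex_minimal_closed_invariant_subset:
  assumes sys: "topological_system G mul X T"
  obtains Y where "closedin X Y" "Y \<noteq> {}" "\<And>g. g \<in> G \<Longrightarrow> T g ` Y \<subseteq> Y"
    "\<And>Z. \<lbrakk>closedin X Z; Z \<noteq> {}; Z \<subseteq> Y; \<And>g. g \<in> G \<Longrightarrow> T g ` Z \<subseteq> Z\<rbrakk> \<Longrightarrow> Z = Y"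
proof -
  interpret topological_system G mul X T by fact
  define inv where "inv Y \<longleftrightarrow> (\<forall>g\<in>G. T g ` Y \<subseteq> Y)" for Y
  define \<A> where "\<A> = {U. openin X U \<and> U \<noteq> topspace X \<and> inv (topspace X - U)}"
  have "\<exists>M\<in>\<A>. \<forall>U\<in>\<A>. M \<subseteq> U \<longrightarrow> U = M"
  proof (rule subset_Zorn_nonempty)
    have "T g x \<in> topspace X" if "g \<in> G" "x \<in> topspace X" for g x
      using continuous[OF that(1)] that(2) by (auto simp: continuous_map_def)
    then have "{} \<in> \<A>"
      using nonempty[symmetric] by (auto simp: \<A>_def inv_def)
    then show "\<A> \<noteq> {}" by blast
  next
    fix \<C> assume ne: "\<C> \<noteq> {}" and chain: "subset.chain \<A> \<C>"
    then have sub: "\<C> \<subseteq> \<A>"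
      by (simp add: subset.chain_def)
    have "\<Union>\<C> \<noteq> topspace X"
    proof
      assume "\<Union>\<C> = topspace X"
      moreover have "\<forall>U\<in>\<C>. openin X U"
        using sub by (auto simp: \<A>_def)
      ultimately obtain \<F> where \<F>: "finite \<F>" "\<F> \<subseteq> \<C>" "\<Union>\<F> = topspace X"
        using compact unfolding compact_space by meson
      then have "\<F> \<noteq> {}"
        using nonempty[symmetric] by auto
      moreover have "subset.chain \<A> \<F>"
        using chain \<F>(2) unfolding subset.chain_def by blast
      ultimately have "\<Union>\<F> \<in> \<F>"
        using \<F>(1) by (simp add: Union_in_chain)
      then show False
        using \<F> sub by (auto simp: \<A>_def)
    qed
    moreover have "inv (topspace X - \<Union>\<C>)"
    proof -
      have "T g x \<in> topspace X - U" if "g \<in> G" "x \<in> topspace X - \<Union>\<C>" "U \<in> \<C>" for g x U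
      proof -
        have "inv (topspace X - U)" "x \<in> topspace X - U"
          using that sub by (auto simp: \<A>_def)
        then show ?thesis
          using that(1) by (auto simp: inv_def)
      qed
      then show ?thesis
        using ne unfolding inv_def by blast
    qed
    ultimately show "\<Union>\<C> \<in> \<A>"
      using sub by (auto simp: \<A>_def)
  qed
  then obtain M where M: "M \<in> \<A>" "\<And>U. U \<in> \<A> \<Longrightarrow> M \<subseteq> U \<Longrightarrow> U = M"
    by blast
  show thesis
  proof (rule that[of "topspace X - M"])
    show "closedin X (topspace X - M)" "topspace X - M \<noteq> {}"
      using M(1) by (auto simp: \<A>_def openin_subset dest: openin_subset)
    show "T g ` (topspace X - M) \<subseteq> topspace X - M" if "g \<in> G" for g
      using M(1) that by (auto simp: \<A>_def inv_def)
    fix Z assume Z: "closedin X Z" "Z \<noteq> {}" "Z \<subseteq> topspace X - M"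
      "\<And>g. g \<in> G \<Longrightarrow> T g ` Z \<subseteq> Z"
    have eq: "topspace X - (topspace X - Z) = Z"
      using closedin_subset[OF Z(1)] by blast
    have "topspace X - Z \<in> \<A>"
      using Z eq by (auto simp: \<A>_def inv_def)
    moreover have "M \<subseteq> topspace X - Z"
      using Z(3) M(1) by (auto simp: \<A>_def dest: openin_subset)
    ultimately have "topspace X - Z = M"
      by (rule M(2))
    then show "Z = topspace X - M"
      using eq by blast
  qed
qed

lemma group_orbit_closure:
  fixes S :: "'a::group_add \<Rightarrow> 'x \<Rightarrow> 'x"
  assumes sys: "topological_system UNIV (+) X S" and x: "x \<in> topspace X"
  shows "closedin X (orbit_closure UNIV X S x)" "\<And>u. S u x \<in> orbit_closure UNIV X S x"
    "\<And>u. S u ` orbit_closure UNIV X S x \<subseteq> orbit_closure UNIV X S x"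
    "\<And>Z. \<lbrakk>closedin X Z; \<And>u. S u x \<in> Z\<rbrakk> \<Longrightarrow> orbit_closure UNIV X S x \<subseteq> Z"
    "topological_system UNIV (+) (subtopology X (orbit_closure UNIV X S x)) S"
proof -
  interpret topological_system UNIV "(+)" X S by fact
  have orb: "{S u x |u. u \<in> UNIV} \<subseteq> topspace X"
    using continuous x by (fastforce simp: continuous_map_def)
  show cl: "closedin X (orbit_closure UNIV X S x)"
    by (simp add: orbit_closure_def)
  show mem: "S u x \<in> orbit_closure UNIV X S x" for u
    using closure_of_subset[OF orb] by (auto simp: orbit_closure_def)
  have "S u ` {S v x |v. v \<in> UNIV} \<subseteq> {S v x |v. v \<in> UNIV}" for u
    using action x by auto
  then show inv: "S u ` orbit_closure UNIV X S x \<subseteq> orbit_closure UNIV X S x" for u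
    unfolding orbit_closure_def
    by (meson UNIV_I closure_of_mono continuous continuous_map_image_closure_subset order_trans)
  show "orbit_closure UNIV X S x \<subseteq> Z" if "closedin X Z" "\<And>u. S u x \<in> Z" for Z
    unfolding orbit_closure_def using that by (intro closure_of_minimal) auto
  show "topological_system UNIV (+) (subtopology X (orbit_closure UNIV X S x)) S"
    using mem by (intro closed_invariant_subsystem[OF sys cl _ inv]) auto
qed

lemma minimal_point_iff_group:
  fixes S :: "'a::group_add \<Rightarrow> 'x \<Rightarrow> 'x"
  assumes sys: "topological_system UNIV (+) X S" and x: "x \<in> topspace X"
  shows "minimal_point UNIV (+) X S x \<longleftrightarrow>
    (\<forall>Z. closedin X Z \<longrightarrow> Z \<noteq> {} \<longrightarrow> Z \<subseteq> orbit_closure UNIV X S x \<longrightarrow> (\<forall>u. S u ` Z \<subseteq> Z) \<longrightarrow>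
      Z = orbit_closure UNIV X S x)"
proof -
  note orb = group_orbit_closure[OF sys x]
  have top: "topspace (subtopology X (orbit_closure UNIV X S x)) = orbit_closure UNIV X S x"
    using closedin_subset[OF orb(1)] by (rule topspace_subtopology_subset)
  show ?thesis
    by (simp add: minimal_point_def minimal_system_def closedin_closed_subtopology[OF orb(1)]
        x orb(5) top del: topspace_subtopology) blast
qed

lemma ex_minimal_point:
  fixes S :: "'a::group_add \<Rightarrow> 'x \<Rightarrow> 'x"
  assumes sys: "topological_system UNIV (+) X S"
  shows "\<exists>x. minimal_point UNIV (+) X S x"
proof -
  obtain Y where Y: "closedin X Y" "Y \<noteq> {}" "\<And>u. S u ` Y \<subseteq> Y"
    "\<And>Z. \<lbrakk>closedin X Z; Z \<noteq> {}; Z \<subseteq> Y; \<And>u. S u ` Z \<subseteq> Z\<rbrakk> \<Longrightarrow> Z = Y"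
    using ex_minimal_closed_invariant_subset[OF sys] by (metis UNIV_I)
  then obtain x where x: "x \<in> Y" by blast
  then have xX: "x \<in> topspace X"
    using Y(1) closedin_subset by blast
  note orb = group_orbit_closure[OF sys xX]
  have "orbit_closure UNIV X S x \<subseteq> Y"
    using Y(1,3) x by (intro orb(4)) auto
  then have "orbit_closure UNIV X S x = Y"
    using orb(1-3) by (intro Y(4)) auto
  then have "minimal_point UNIV (+) X S x"
    using Y(4) unfolding minimal_point_iff_group[OF sys xX] by auto
  then show ?thesis ..
qed

definition syndetic :: "'a::group_add set \<Rightarrow> bool" where
  "syndetic R \<longleftrightarrow> (\<exists>F. finite F \<and> (\<forall>v. \<exists>u\<in>F. u + v \<in> R))"

lemma syndeticI: "finite F \<Longrightarrow> (\<And>v. \<exists>u\<in>F. u + v \<in> R) \<Longrightarrow> syndetic R"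
  by (auto simp: syndetic_def)

text \<open>Minimality of a point is the same as uniform recurrence.  If the orbit closure \<open>Q\<close> is minimal,
  the translates of a neighbourhood of \<open>x\<close> cover \<open>Q\<close>, as what they miss is a closed invariant
  proper subset; finitely many translates suffice, and they witness syndeticity.  Conversely, if
  \<open>x\<close> is missing from a closed invariant subset \<open>Z\<close> of \<open>Q\<close>, then finitely many translates of a closed
  neighbourhood of \<open>x\<close> disjoint from \<open>Z\<close> cover the orbit, hence \<open>Q\<close>, so \<open>Z\<close> is empty.\<close>

lemma minimal_point_iff_syndetic_returns:
  fixes S :: "'a::group_add \<Rightarrow> 'x \<Rightarrow> 'x"
  assumes sys: "topological_system UNIV (+) X S" and x: "x \<in> topspace X"
  shows "minimal_point UNIV (+) X S x \<longleftrightarrow>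
    (\<forall>V. openin X V \<longrightarrow> x \<in> V \<longrightarrow> syndetic {u. S u x \<in> V})"
proof -
  interpret topological_system UNIV "(+)" X S by fact
  define Q where "Q = orbit_closure UNIV X S x"
  note orb = group_orbit_closure[OF sys x, folded Q_def]
  have zero: "S 0 y = y" if "y \<in> topspace X" for y
    using action_identity[of 0] that by simp
  have xO: "x \<in> Q"
    using orb(2)[of 0] zero[OF x] by simp
  have OX: "Q \<subseteq> topspace X"
    using orb(1) by (rule closedin_subset)
  have top: "S u y \<in> topspace X" if "y \<in> topspace X" for u y
    using continuous[of u] that by (auto simp: continuous_map_def)
  have comp: "S u (S v y) = S (u + v) y" if "y \<in> topspace X" for u v y
    using action that by simp
  show ?thesis
  proof
    assume min: "minimal_point UNIV (+) X S x"
    show "\<forall>V. openin X V \<longrightarrow> x \<in> V \<longrightarrow> syndetic {u. S u x \<in> V}"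
    proof (intro allI impI)
      fix V assume V: "openin X V" "x \<in> V"
      define W where "W u = {y \<in> topspace X. S u y \<in> V}" for u
      have W: "openin X (W u)" for u
        unfolding W_def using continuous V(1) by (intro openin_continuous_map_preimage) auto
      define Z where "Z = Q - (\<Union>u. W u)"
      have "closedin X Z"
        unfolding Z_def using orb(1) W by (intro closedin_diff openin_Union) auto
      moreover have "S u ` Z \<subseteq> Z" for u
        using orb(3)[of u] OX comp by (auto simp: Z_def W_def)
      moreover have "x \<notin> Z"
        using zero x V(2) by (auto simp: Z_def W_def intro!: exI[of _ 0])
      moreover have "Z \<subseteq> Q"
        by (auto simp: Z_def)
      ultimately have "Z = {}"
        using min xO unfolding minimal_point_iff_group[OF sys x, folded Q_def] by metis
      then have "Q \<subseteq> \<Union>(range W)"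
        by (auto simp: Z_def)
      moreover have "compactin X Q"
        using compact orb(1) by (rule closedin_compact_space)
      ultimately obtain \<F> where \<F>: "finite \<F>" "\<F> \<subseteq> range W" "Q \<subseteq> \<Union>\<F>"
        using W unfolding compactin_def by (metis (no_types, lifting) imageE)
      then obtain F where F: "finite F" "\<F> = W ` F"
        by (meson finite_subset_image)
      have "\<exists>u\<in>F. S (u + v) x \<in> V" for v
        using \<F>(3) F(2) orb(2)[of v] comp x by (force simp: W_def)
      then show "syndetic {u. S u x \<in> V}"
        using F(1) by (auto simp: syndetic_def)
    qed
  next
    assume rec: "\<forall>V. openin X V \<longrightarrow> x \<in> V \<longrightarrow> syndetic {u. S u x \<in> V}"
    have "Z = Q" if Z: "closedin X Z" "Z \<noteq> {}" "Z \<subseteq> Q" "\<forall>u. S u ` Z \<subseteq> Z" for Z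
    proof -
      have "x \<in> Z"
      proof (rule ccontr)
        assume "x \<notin> Z"
        then obtain V where V: "openin X V" "x \<in> V" "disjnt Z (X closure_of V)"
          using compact_Hausdorff_imp_regular_space[OF compact Hausdorff] Z(1) x
          unfolding regular_space by blast
        define W where "W u = {y \<in> topspace X. S u y \<in> X closure_of V}" for u
        have W: "closedin X (W u)" for u
          unfolding W_def using continuous by (intro closedin_continuous_map_preimage) auto
        obtain F where F: "finite F" "\<And>v. \<exists>u\<in>F. S (u + v) x \<in> V"
          using rec V(1,2) by (auto simp: syndetic_def)
        have "S v x \<in> (\<Union>u\<in>F. W u)" for v
        proof -
          obtain u where "u \<in> F" "S (u + v) x \<in> V"
            using F(2) by blast
          then show ?thesis
            using top comp x closure_of_subset[OF openin_subset[OF V(1)]]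
            by (auto simp: W_def intro!: bexI[of _ u])
        qed
        moreover have "closedin X (\<Union>u\<in>F. W u)"
          using W F(1) by (intro closedin_Union) auto
        ultimately have "Q \<subseteq> (\<Union>u\<in>F. W u)"
          by (intro orb(4)) auto
        then obtain z u where "z \<in> Z" "S u z \<in> X closure_of V"
          using Z(2,3) by (fastforce simp: W_def)
        then show False
          using V(3) Z(4) by (auto simp: disjnt_def)
      qed
      then have "Q \<subseteq> Z"
        using Z(1,4) by (intro orb(4)) auto
      then show ?thesis
        using Z(3) by blast
    qed
    then show "minimal_point UNIV (+) X S x"
      unfolding minimal_point_iff_group[OF sys x, folded Q_def] by blast
  qed
qed

section \<open>The space of ultrafilters\<close>

text \<open>A set of subsets is an ultrafilter exactly when membership in it is a homomorphism of Boolean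
  algebras.  In this form the condition involves only two or three memberships at a time, so it
  defines a closed subset of the Cantor cube below.\<close>

definition is_ultrafilter :: "'a set set \<Rightarrow> bool" where
  "is_ultrafilter p \<longleftrightarrow> (\<forall>A B. A \<inter> B \<in> p \<longleftrightarrow> A \<in> p \<and> B \<in> p) \<and> (\<forall>A. - A \<in> p \<longleftrightarrow> A \<notin> p)"

lemma
  assumes "is_ultrafilter p"
  shows ultrafilter_Int: "A \<inter> B \<in> p \<longleftrightarrow> A \<in> p \<and> B \<in> p"
    and ultrafilter_Compl: "- A \<in> p \<longleftrightarrow> A \<notin> p"
  using assms by (auto simp: is_ultrafilter_def)

lemma ultrafilter_mono:
  assumes "is_ultrafilter p" "A \<in> p" "A \<subseteq> B"
  shows "B \<in> p"
  using ultrafilter_Int[OF assms(1), of A B] assms(2,3) by (simp add: Int_absorb2)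

lemma ultrafilter_empty: "is_ultrafilter p \<Longrightarrow> {} \<notin> p"
  using ultrafilter_mono[of p "{}" "- {}"] ultrafilter_Compl[of p "{}"] by blast

lemma ultrafilter_UNIV: "is_ultrafilter p \<Longrightarrow> UNIV \<in> p"
  using ultrafilter_Compl[of p "{}"] ultrafilter_empty[of p] by simp

lemma ultrafilter_INT:
  assumes "is_ultrafilter p" "finite I"
  shows "(\<Inter>i\<in>I. A i) \<in> p \<longleftrightarrow> (\<forall>i\<in>I. A i \<in> p)"
  using assms(2) by induction (auto simp: ultrafilter_UNIV ultrafilter_Int assms(1))

lemma ultrafilter_UN:
  assumes "is_ultrafilter p" "finite I"
  shows "(\<Union>i\<in>I. A i) \<in> p \<longleftrightarrow> (\<exists>i\<in>I. A i \<in> p)"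
  using ultrafilter_INT[OF assms, of "\<lambda>i. - A i"]
    ultrafilter_Compl[OF assms(1), of "\<Union>i\<in>I. A i"] ultrafilter_Compl[OF assms(1)]
  by (simp add: Compl_UN) blast

lemma principal_ultrafilter: "is_ultrafilter {A. x \<in> A}"
  by (auto simp: is_ultrafilter_def)

text \<open>The Cantor cube, with its points written as sets in place of their characteristic
  functions.\<close>

definition cantor_cube :: "'a set topology" where
  "cantor_cube = pullback_topology UNIV (\<lambda>p a. a \<in> p) (product_topology (\<lambda>_. discrete_topology UNIV) UNIV)"

lemma topspace_cantor_cube [simp]: "topspace cantor_cube = UNIV"
  by (simp add: cantor_cube_def topspace_pullback_topology)

lemma cantor_cube_homeomorphic_product:
  "(cantor_cube :: 'a set topology) homeomorphic_space
    product_topology (\<lambda>_::'a. discrete_topology (UNIV :: bool set)) UNIV"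
proof -
  let ?P = "product_topology (\<lambda>_::'a. discrete_topology (UNIV :: bool set)) UNIV"
  have "continuous_map cantor_cube ?P (id \<circ> (\<lambda>p a. a \<in> p))"
    unfolding cantor_cube_def by (intro continuous_map_pullback) simp
  moreover have "continuous_map ?P cantor_cube Collect"
    unfolding cantor_cube_def by (intro continuous_map_pullback') (auto simp: comp_def)
  ultimately have "homeomorphic_maps cantor_cube ?P (\<lambda>p a. a \<in> p) Collect"
    by (auto simp: homeomorphic_maps_def)
  then show ?thesis
    unfolding homeomorphic_space_def by blast
qed

lemma compact_space_cantor_cube: "compact_space cantor_cube"
  by (simp add: homeomorphic_compact_space[OF cantor_cube_homeomorphic_product]
      compact_space_product_topology compact_space_discrete_topology)

lemma Hausdorff_space_cantor_cube: "Hausdorff_space cantor_cube"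
  by (simp add: homeomorphic_Hausdorff_space[OF cantor_cube_homeomorphic_product]
      Hausdorff_space_product_topology)

lemma openin_cantor_cube:
  "openin cantor_cube V \<longleftrightarrow>
    (\<forall>p\<in>V. \<exists>F. finite F \<and> (\<forall>q. (\<forall>a\<in>F. a \<in> q \<longleftrightarrow> a \<in> p) \<longrightarrow> q \<in> V))"
proof
  assume "openin cantor_cube V"
  then obtain W where W: "openin (product_topology (\<lambda>_. discrete_topology UNIV) UNIV) W"
    "V = (\<lambda>p a. a \<in> p) -` W"
    by (auto simp: cantor_cube_def openin_pullback_topology)
  show "\<forall>p\<in>V. \<exists>F. finite F \<and> (\<forall>q. (\<forall>a\<in>F. a \<in> q \<longleftrightarrow> a \<in> p) \<longrightarrow> q \<in> V)"
  proof
    fix p assume "p \<in> V"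
    then obtain U where U: "finite {a. U a \<noteq> UNIV}" "(\<lambda>a. a \<in> p) \<in> Pi\<^sub>E UNIV U" "Pi\<^sub>E UNIV U \<subseteq> W"
      using W unfolding openin_product_topology_alt by fastforce
    have "q \<in> V" if q: "\<forall>a\<in>{a. U a \<noteq> UNIV}. a \<in> q \<longleftrightarrow> a \<in> p" for q
    proof -
      have "(a \<in> q) \<in> U a" for a
        using q U(2) by (cases "U a = UNIV") (auto simp: PiE_iff)
      then show ?thesis
        using U(3) W(2) by (auto simp: PiE_iff)
    qed
    then show "\<exists>F. finite F \<and> (\<forall>q. (\<forall>a\<in>F. a \<in> q \<longleftrightarrow> a \<in> p) \<longrightarrow> q \<in> V)"
      using U(1) by blast
  qed
next
  assume V: "\<forall>p\<in>V. \<exists>F. finite F \<and> (\<forall>q. (\<forall>a\<in>F. a \<in> q \<longleftrightarrow> a \<in> p) \<longrightarrow> q \<in> V)"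
  have "openin (product_topology (\<lambda>_. discrete_topology UNIV) UNIV) {f. Collect f \<in> V}"
    unfolding openin_product_topology_alt
  proof
    fix f assume "f \<in> {f. Collect f \<in> V}"
    then obtain F where F: "finite F" "\<forall>q. (\<forall>a\<in>F. a \<in> q \<longleftrightarrow> f a) \<longrightarrow> q \<in> V"
      using V by auto
    let ?U = "\<lambda>a. if a \<in> F then {f a} else UNIV"
    have "{a. ?U a \<noteq> UNIV} \<subseteq> F"
      by auto
    then have "finite {a. ?U a \<noteq> UNIV}"
      using F(1) by (rule finite_subset)
    moreover have "f \<in> Pi\<^sub>E UNIV ?U"
      by (auto simp: PiE_iff)
    moreover have "Pi\<^sub>E UNIV ?U \<subseteq> {f. Collect f \<in> V}"
    proof
      fix h assume "h \<in> Pi\<^sub>E UNIV ?U"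
      then have "\<forall>a\<in>F. h a = f a"
        by (auto simp: PiE_iff split: if_splits)
      then show "h \<in> {f. Collect f \<in> V}"
        using F(2) by simp
    qed
    ultimately show "\<exists>U. finite {i \<in> UNIV. U i \<noteq> topspace (discrete_topology UNIV)} \<and>
        (\<forall>i\<in>UNIV. openin (discrete_topology UNIV) (U i)) \<and> f \<in> Pi\<^sub>E UNIV U \<and>
        Pi\<^sub>E UNIV U \<subseteq> {f. Collect f \<in> V}"
      by (intro exI[of _ ?U]) simp
  qed
  moreover have "V = (\<lambda>p a. a \<in> p) -` {f. Collect f \<in> V} \<inter> UNIV"
    by auto
  ultimately show "openin cantor_cube V"
    unfolding cantor_cube_def openin_pullback_topology by blast
qed

lemma closedin_ultrafilters: "closedin cantor_cube {p. is_ultrafilter p \<and> \<B> \<subseteq> p}"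
proof -
  have "openin cantor_cube (- {p. is_ultrafilter p \<and> \<B> \<subseteq> p})"
    unfolding openin_cantor_cube
  proof
    fix p assume "p \<in> - {p. is_ultrafilter p \<and> \<B> \<subseteq> p}"
    then consider A B where "\<not> (A \<inter> B \<in> p \<longleftrightarrow> A \<in> p \<and> B \<in> p)"
      | A where "\<not> (- A \<in> p \<longleftrightarrow> A \<notin> p)" | A where "A \<in> \<B>" "A \<notin> p"
      unfolding is_ultrafilter_def by blast
    then show "\<exists>F. finite F \<and> (\<forall>q. (\<forall>A\<in>F. A \<in> q \<longleftrightarrow> A \<in> p) \<longrightarrow>
        q \<in> - {p. is_ultrafilter p \<and> \<B> \<subseteq> p})"
    proof cases
      case (1 A B)
      then show ?thesis
        by (intro exI[of _ "{A \<inter> B, A, B}"]) (auto dest: ultrafilter_Int[of _ A B])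
    next
      case (2 A)
      then show ?thesis
        by (intro exI[of _ "{- A, A}"]) (auto dest: ultrafilter_Compl[of _ A])
    next
      case (3 A)
      then show ?thesis
        by (intro exI[of _ "{A}"]) auto
    qed
  qed
  then show ?thesis
    by (simp add: closedin_def Compl_eq_Diff_UNIV)
qed

text \<open>A single member of an ultrafilter decides any prescribed finite set of memberships, so on
  ultrafilters the sets \<open>{q. A \<in> q}\<close> form a base, not merely a subbase.\<close>

lemma openin_ultrafilter_space:
  assumes Y: "Y \<subseteq> Collect is_ultrafilter"
  shows "openin (subtopology cantor_cube Y) V \<longleftrightarrow>
    V \<subseteq> Y \<and> (\<forall>p\<in>V. \<exists>A\<in>p. {q \<in> Y. A \<in> q} \<subseteq> V)"
proof
  assume "openin (subtopology cantor_cube Y) V"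
  then obtain W where W: "openin cantor_cube W" "V = W \<inter> Y"
    unfolding openin_subtopology by blast
  have "\<exists>A\<in>p. {q \<in> Y. A \<in> q} \<subseteq> V" if p: "p \<in> V" for p
  proof -
    obtain F where F: "finite F" "\<And>q. (\<forall>a\<in>F. a \<in> q \<longleftrightarrow> a \<in> p) \<Longrightarrow> q \<in> W"
      using W p unfolding openin_cantor_cube by blast
    have up: "is_ultrafilter p"
      using Y p W(2) by blast
    let ?A = "\<Inter>a\<in>F. if a \<in> p then a else - a"
    have "(if a \<in> p then a else - a) \<in> p" for a
      using ultrafilter_Compl[OF up, of a] by simp
    then have "?A \<in> p"
      unfolding ultrafilter_INT[OF up F(1)] by blast
    moreover have "q \<in> V" if q: "q \<in> Y" "?A \<in> q" for q
    proof -
      have uq: "is_ultrafilter q"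
        using Y q(1) by blast
      have "\<forall>a\<in>F. (if a \<in> p then a else - a) \<in> q"
        using q(2) unfolding ultrafilter_INT[OF uq F(1)] .
      then have "a \<in> q \<longleftrightarrow> a \<in> p" if "a \<in> F" for a
        using ultrafilter_Compl[OF uq, of a] that by (auto split: if_splits)
      then show ?thesis
        using F(2) W(2) q(1) by blast
    qed
    ultimately show ?thesis
      by blast
  qed
  then show "V \<subseteq> Y \<and> (\<forall>p\<in>V. \<exists>A\<in>p. {q \<in> Y. A \<in> q} \<subseteq> V)"
    using W(2) by blast
next
  assume V: "V \<subseteq> Y \<and> (\<forall>p\<in>V. \<exists>A\<in>p. {q \<in> Y. A \<in> q} \<subseteq> V)"
  let ?W = "{q. \<exists>A\<in>q. {q \<in> Y. A \<in> q} \<subseteq> V}"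
  have "openin cantor_cube ?W"
    unfolding openin_cantor_cube
  proof
    fix p assume "p \<in> ?W"
    then obtain A where "A \<in> p" "{q \<in> Y. A \<in> q} \<subseteq> V" by blast
    then show "\<exists>F. finite F \<and> (\<forall>q. (\<forall>a\<in>F. a \<in> q \<longleftrightarrow> a \<in> p) \<longrightarrow> q \<in> ?W)"
      by (intro exI[of _ "{A}"]) auto
  qed
  moreover have "V = ?W \<inter> Y"
    using V by blast
  ultimately show "openin (subtopology cantor_cube Y) V"
    unfolding openin_subtopology by blast
qed

definition push :: "('a \<Rightarrow> 'b) \<Rightarrow> 'a set set \<Rightarrow> 'b set set" where
  "push g p = {A. g -` A \<in> p}"

lemma mem_push [simp]: "A \<in> push g p \<longleftrightarrow> g -` A \<in> p"
  by (simp add: push_def)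

lemma push_push: "push g (push h p) = push (g \<circ> h) p"
  by (simp add: push_def vimage_comp)

lemma push_id: "push id p = p"
  by (simp add: push_def)

lemma ultrafilter_push: "is_ultrafilter p \<Longrightarrow> is_ultrafilter (push g p)"
  by (simp add: is_ultrafilter_def vimage_Compl)

lemma image_mem_push: "inj g \<Longrightarrow> g ` A \<in> push g p \<longleftrightarrow> A \<in> p"
  by (simp add: inj_vimage_image_eq)

lemma inj_push: "inj g \<Longrightarrow> inj (push g)"
  by (rule injI) (metis image_mem_push set_eqI)

lemma ultrafilter_eq_push:
  assumes q: "is_ultrafilter q" and g: "inj g" "range g \<in> q"
  shows "is_ultrafilter {A. g ` A \<in> q}" "push g {A. g ` A \<in> q} = q"
proof -
  have "g ` (A \<inter> B) \<in> q \<longleftrightarrow> g ` A \<in> q \<and> g ` B \<in> q" for A B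
    using ultrafilter_Int[OF q] by (simp add: image_Int[OF g(1)])
  moreover have "g ` (- A) \<in> q \<longleftrightarrow> g ` A \<notin> q" for A
  proof -
    have "g ` (- A) = range g \<inter> - g ` A"
      using g(1) by (auto simp: inj_def)
    then show ?thesis
      using g(2) by (simp add: ultrafilter_Int[OF q] ultrafilter_Compl[OF q])
  qed
  ultimately show "is_ultrafilter {A. g ` A \<in> q}"
    by (simp add: is_ultrafilter_def)
  have "g ` (g -` A) \<in> q \<longleftrightarrow> A \<in> q" for A
    using g(2) by (simp add: image_vimage_eq ultrafilter_Int[OF q])
  then show "push g {A. g ` A \<in> q} = q"
    by (simp add: push_def)
qed

lemma continuous_map_push:
  assumes Y: "Y \<subseteq> Collect is_ultrafilter" and inv: "push g ` Y \<subseteq> Y"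
  shows "continuous_map (subtopology cantor_cube Y) (subtopology cantor_cube Y) (push g)"
proof -
  have "openin (subtopology cantor_cube Y) {p \<in> Y. push g p \<in> V}"
    if V: "openin (subtopology cantor_cube Y) V" for V
    unfolding openin_ultrafilter_space[OF Y]
  proof (intro conjI ballI)
    fix p assume "p \<in> {p \<in> Y. push g p \<in> V}"
    then obtain A where "A \<in> push g p" "{q \<in> Y. A \<in> q} \<subseteq> V"
      using V unfolding openin_ultrafilter_space[OF Y] by blast
    then show "\<exists>A\<in>p. {q \<in> Y. A \<in> q} \<subseteq> {p \<in> Y. push g p \<in> V}"
      using inv by (intro bexI[of _ "g -` A"]) (auto simp: subset_iff)
  qed auto
  then show ?thesis
    using inv by (auto simp: continuous_map_def)
qed

section \<open>Ultrafilters concentrated at plus infinity\<close>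

lemma affine_semigroup_iff: "g \<in> affine_semigroup \<longleftrightarrow> (\<exists>a b. 1 \<le> a \<and> g = (\<lambda>x. a * x + b))"
  by (auto simp: affine_semigroup_def pos_ints_def)

lemma translation_in_affine_semigroup: "translation u \<in> affine_semigroup"
  unfolding affine_semigroup_iff translation_def by (intro exI[of _ 1] exI[of _ u]) simp

lemma translation_0: "translation 0 = id"
  by (simp add: translation_def fun_eq_iff)

lemma translation_comp: "translation u \<circ> translation v = translation (u + v)"
  by (simp add: translation_def fun_eq_iff)

lemma id_in_affine_semigroup: "id \<in> affine_semigroup"
  using translation_in_affine_semigroup[of 0] by (simp add: translation_0)

lemma comp_in_affine_semigroup:
  assumes "g \<in> affine_semigroup" "h \<in> affine_semigroup"
  shows "g \<circ> h \<in> affine_semigroup"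
proof -
  obtain a b c d where "1 \<le> a" "g = (\<lambda>x. a * x + b)" "1 \<le> c" "h = (\<lambda>x. c * x + d)"
    using assms unfolding affine_semigroup_iff by blast
  moreover have "1 * 1 \<le> a * c"
    using calculation by (intro mult_mono) auto
  ultimately show ?thesis
    unfolding affine_semigroup_iff
    by (intro exI[of _ "a * c"] exI[of _ "a * d + b"]) (simp add: fun_eq_iff algebra_simps)
qed

lemma inj_affine_semigroup: "g \<in> affine_semigroup \<Longrightarrow> inj g"
  unfolding affine_semigroup_iff inj_def by auto

definition infinity_ultrafilters :: "int set set set" where
  "infinity_ultrafilters = {p. is_ultrafilter p \<and> range atLeast \<subseteq> p}"

lemma infinity_ultrafiltersD:
  assumes "p \<in> infinity_ultrafilters"
  shows "is_ultrafilter p" "{n..} \<in> p"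
  using assms by (auto simp: infinity_ultrafilters_def)

text \<open>By compactness, since each single ray \<open>{n..}\<close> belongs to the principal ultrafilter at \<open>n\<close>.\<close>

lemma infinity_ultrafilters_nonempty: "infinity_ultrafilters \<noteq> {}"
proof -
  define C where "C n = {p. is_ultrafilter p \<and> {{int n..}} \<subseteq> p}" for n
  have "(\<Inter>n. C n) \<noteq> {}"
  proof (rule compact_space_imp_nest[OF compact_space_cantor_cube])
    show "closedin cantor_cube (C n)" for n
      unfolding C_def by (rule closedin_ultrafilters)
    show "C n \<noteq> {}" for n
      using principal_ultrafilter[of "int n"] unfolding C_def by fastforce
    show "decseq C"
      unfolding decseq_def C_def by (auto elim: ultrafilter_mono)
  qed
  then obtain p where p: "\<And>n. p \<in> C n"
    by blast
  then have up: "is_ultrafilter p"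
    by (simp add: C_def)
  have "{n..} \<in> p" for n
    using p[of "nat n"] by (auto simp: C_def elim: ultrafilter_mono[OF up])
  then have "p \<in> infinity_ultrafilters"
    using up by (auto simp: infinity_ultrafilters_def)
  then show ?thesis
    by blast
qed

lemma push_infinity_ultrafilters:
  assumes g: "g \<in> affine_semigroup" and p: "p \<in> infinity_ultrafilters"
  shows "push g p \<in> infinity_ultrafilters"
proof -
  obtain a b where ab: "1 \<le> a" "g = (\<lambda>x. a * x + b)"
    using g unfolding affine_semigroup_iff by blast
  have "{n..} \<in> push g p" for n
  proof -
    have "{max 0 (n - b)..} \<subseteq> g -` {n..}"
    proof
      fix x assume x: "x \<in> {max 0 (n - b)..}"
      then have "1 * x \<le> a * x"
        using ab(1) by (intro mult_right_mono) auto
      then show "x \<in> g -` {n..}"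
        using x by (simp add: ab(2))
    qed
    then show ?thesis
      unfolding mem_push
      using ultrafilter_mono[OF infinity_ultrafiltersD[OF p]] by blast
  qed
  then show ?thesis
    using ultrafilter_push infinity_ultrafiltersD(1)[OF p] by (auto simp: infinity_ultrafilters_def)
qed

lemma infinity_ultrafilter_eq_push:
  assumes g: "g \<in> affine_semigroup" and q: "q \<in> infinity_ultrafilters" and A: "g ` A \<in> q"
  obtains p where "p \<in> infinity_ultrafilters" "A \<in> p" "push g p = q"
proof -
  obtain a b where ab: "1 \<le> a" "g = (\<lambda>x. a * x + b)"
    using g unfolding affine_semigroup_iff by blast
  note uq = infinity_ultrafiltersD[OF q]
  have rg: "range g \<in> q"
    using image_mono[OF subset_UNIV] by (rule ultrafilter_mono[OF uq(1) A])
  note pull = ultrafilter_eq_push[OF uq(1) inj_affine_semigroup[OF g] rg]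
  have "g ` {n..} \<in> q" for n
  proof -
    have "range g \<inter> {a * n + b..} \<subseteq> g ` {n..}"
      using ab(1) by (auto simp: ab(2))
    moreover have "range g \<inter> {a * n + b..} \<in> q"
      using rg uq(2) by (simp add: ultrafilter_Int[OF uq(1)])
    ultimately show ?thesis
      by (rule ultrafilter_mono[OF uq(1), rotated])
  qed
  then have "{A. g ` A \<in> q} \<in> infinity_ultrafilters"
    using pull(1) by (auto simp: infinity_ultrafilters_def)
  then show thesis
    using that A pull(2) by blast
qed

lemma affine_system:
  assumes Y: "closedin cantor_cube Y" "Y \<noteq> {}" "Y \<subseteq> infinity_ultrafilters"
    and inv: "\<And>g. g \<in> affine_semigroup \<Longrightarrow> push g ` Y \<subseteq> Y"
  shows "topological_system affine_semigroup (\<circ>) (subtopology cantor_cube Y) push"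
proof (unfold_locales)
  show "g \<circ> h \<in> affine_semigroup" if "g \<in> affine_semigroup" "h \<in> affine_semigroup" for g h
    using that by (rule comp_in_affine_semigroup)
  show "g \<circ> h \<circ> k = g \<circ> (h \<circ> k)" for g h k :: "int \<Rightarrow> int"
    by (rule comp_assoc)
  show "topspace (subtopology cantor_cube Y) \<noteq> {}"
    using Y(2) by simp
  show "compact_space (subtopology cantor_cube Y)"
    using closedin_compact_space[OF compact_space_cantor_cube Y(1)] by (rule compact_space_subtopology)
  show "Hausdorff_space (subtopology cantor_cube Y)"
    by (rule Hausdorff_space_subtopology[OF Hausdorff_space_cantor_cube])
  show "continuous_map (subtopology cantor_cube Y) (subtopology cantor_cube Y) (push g)"
    if "g \<in> affine_semigroup" for g
    using Y(3) infinity_ultrafiltersD(1) inv[OF that] by (intro continuous_map_push) auto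
  show "push g (push h p) = push (g \<circ> h) p" for g h :: "int \<Rightarrow> int" and p
    by (rule push_push)
  show "push e p = p" if "\<forall>g\<in>affine_semigroup. e \<circ> g = g \<and> g \<circ> e = g" for e p
  proof -
    have "e = id"
      using that id_in_affine_semigroup by force
    then show ?thesis
      by (simp add: push_id)
  qed
qed

lemma translation_system:
  assumes "topological_system affine_semigroup (\<circ>) X T"
  shows "topological_system UNIV (+) X (\<lambda>u. T (translation u))"
proof -
  interpret topological_system affine_semigroup "(\<circ>)" X T by fact
  show ?thesis
  proof (unfold_locales)
    show "topspace X \<noteq> {}" "compact_space X" "Hausdorff_space X"
      by (rule nonempty compact Hausdorff)+
    show "continuous_map X X (T (translation u))" for u
      by (rule continuous[OF translation_in_affine_semigroup])
    show "T (translation u) (T (translation v) x) = T (translation (u + v)) x"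
      if "x \<in> topspace X" for u v x
      using action[OF translation_in_affine_semigroup translation_in_affine_semigroup that]
      by (simp add: translation_comp)
    show "T (translation e) x = x" if "\<forall>u\<in>UNIV. e + u = u \<and> u + e = u" "x \<in> topspace X" for e x
    proof -
      have "e = 0"
        using that(1) by force
      then show ?thesis
        using action_identity[OF id_in_affine_semigroup] that(2) by (simp add: translation_0)
    qed
  qed (simp_all add: add.assoc)
qed

section \<open>Additively recurrent ultrafilters\<close>

definition additively_recurrent :: "int set set \<Rightarrow> bool" where
  "additively_recurrent p \<longleftrightarrow> (\<forall>A\<in>p. syndetic {u. translation u -` A \<in> p})"

lemma syndetic_mono: "syndetic R \<Longrightarrow> R \<subseteq> R' \<Longrightarrow> syndetic R'"
  unfolding syndetic_def by (meson subsetD)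

lemma additively_minimal_iff_recurrent:
  assumes Y: "Y \<subseteq> infinity_ultrafilters" and p: "p \<in> Y"
    and sys: "topological_system affine_semigroup (\<circ>) (subtopology cantor_cube Y) push"
  shows "additively_minimal (subtopology cantor_cube Y) push p \<longleftrightarrow> additively_recurrent p"
proof -
  have Y': "Y \<subseteq> Collect is_ultrafilter"
    using Y infinity_ultrafiltersD(1) by blast
  have inY: "push (translation u) p \<in> Y" for u
    using topological_system.continuous[OF sys translation_in_affine_semigroup] p
    by (auto simp: continuous_map_def)
  have "additively_minimal (subtopology cantor_cube Y) push p \<longleftrightarrow>
    (\<forall>V. openin (subtopology cantor_cube Y) V \<longrightarrow> p \<in> V \<longrightarrow> syndetic {u. push (translation u) p \<in> V})"
    unfolding additively_minimal_def
    using p by (intro minimal_point_iff_syndetic_returns translation_system[OF sys]) simp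
  also have "\<dots> \<longleftrightarrow> additively_recurrent p"
    unfolding additively_recurrent_def
  proof (intro iffI ballI allI impI)
    fix A assume all: "\<forall>V. openin (subtopology cantor_cube Y) V \<longrightarrow> p \<in> V \<longrightarrow>
      syndetic {u. push (translation u) p \<in> V}" and A: "A \<in> p"
    have "openin (subtopology cantor_cube Y) {q \<in> Y. A \<in> q}"
      unfolding openin_ultrafilter_space[OF Y'] by blast
    then have "syndetic {u. push (translation u) p \<in> {q \<in> Y. A \<in> q}}"
      using all A p by blast
    then show "syndetic {u. translation u -` A \<in> p}"
      by (rule syndetic_mono) auto
  next
    fix V assume all: "\<forall>A\<in>p. syndetic {u. translation u -` A \<in> p}"
      and V: "openin (subtopology cantor_cube Y) V" "p \<in> V"
    then obtain A where A: "A \<in> p" "{q \<in> Y. A \<in> q} \<subseteq> V"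
      unfolding openin_ultrafilter_space[OF Y'] by blast
    have "{u. translation u -` A \<in> p} \<subseteq> {u. push (translation u) p \<in> V}"
      using A(2) inY by auto
    then show "syndetic {u. push (translation u) p \<in> V}"
      using all A(1) syndetic_mono by blast
  qed
  finally show ?thesis .
qed

text \<open>Return times scale with the dilation factor \<open>a\<close> of \<open>g\<close>.  Returns of \<open>p\<close> become \<open>a\<close>-fold
  returns of \<open>push g p\<close>, and multiplication by \<open>a\<close> keeps a set syndetic because the finitely many
  remainders modulo \<open>a\<close> can be absorbed in the finite set of shifts.  Conversely, \<open>push g p\<close> lives on
  one residue class modulo \<open>a\<close>, so its returns to subsets of that class are all multiples of \<open>a\<close>, and
  dividing them by \<open>a\<close> gives returns of \<open>p\<close>.\<close>

lemma additively_recurrent_push_iff: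
  assumes g: "g \<in> affine_semigroup" and p: "is_ultrafilter p"
  shows "additively_recurrent (push g p) \<longleftrightarrow> additively_recurrent p"
proof -
  obtain a b where ab: "1 \<le> a" "g = (\<lambda>x. a * x + b)"
    using g unfolding affine_semigroup_iff by blast
  have dilate: "g -` (translation (a * v) -` A) = translation v -` (g -` A)" for v A
    by (auto simp: ab(2) translation_def algebra_simps)
  show ?thesis
  proof
    assume rec: "additively_recurrent p"
    show "additively_recurrent (push g p)"
      unfolding additively_recurrent_def
    proof
      fix A assume "A \<in> push g p"
      then obtain F where F: "finite F" "\<And>v. \<exists>u\<in>F. translation (u + v) -` (g -` A) \<in> p"
        using rec unfolding additively_recurrent_def syndetic_def by auto
      let ?F = "(\<lambda>(u, r). a * u - r) ` (F \<times> {0..<a})"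
      have cover: "\<exists>w\<in>?F. translation (w + v) -` A \<in> push g p" for v
      proof -
        obtain u where u: "u \<in> F" "translation (u + v div a) -` (g -` A) \<in> p"
          using F(2) by blast
        have "(a * u - v mod a) + v = a * (u + v div a)"
          using mult_div_mod_eq[of a v] by (simp add: algebra_simps)
        then have "translation ((a * u - v mod a) + v) -` A \<in> push g p"
          using u(2) dilate by simp
        moreover have "a * u - v mod a \<in> ?F"
          using u(1) ab(1) by force
        ultimately show ?thesis
          by blast
      qed
      have "finite ?F"
        using F(1) by simp
      then show "syndetic {u. translation u -` A \<in> push g p}"
        by (rule syndeticI) (unfold mem_Collect_eq, rule cover)
    qed
  next
    assume rec: "additively_recurrent (push g p)"
    show "additively_recurrent p"
      unfolding additively_recurrent_def
    proof
      fix A assume "A \<in> p"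
      then have "g ` A \<in> push g p"
        using image_mem_push[OF inj_affine_semigroup[OF g]] by blast
      then have "syndetic {u. translation u -` (g ` A) \<in> push g p}"
        using rec unfolding additively_recurrent_def by (rule bspec[rotated])
      then obtain F where F: "finite F" "\<And>v. \<exists>u\<in>F. translation (u + v) -` (g ` A) \<in> push g p"
        unfolding syndetic_def mem_Collect_eq by blast
      have cover: "\<exists>u\<in>(\<lambda>u. u div a) ` F. translation (u + v) -` A \<in> p" for v
      proof -
        obtain u where u: "u \<in> F" "g -` (translation (u + a * v) -` (g ` A)) \<in> p"
          using F(2)[of "a * v"] by auto
        then have "g -` (translation (u + a * v) -` (g ` A)) \<noteq> {}"
          using ultrafilter_empty[OF p] by metis
        then obtain x where "x \<in> g -` (translation (u + a * v) -` (g ` A))"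
          by blast
        then obtain y where "a * x + b + (u + a * v) = a * y + b"
          unfolding vimage_eq image_iff ab(2) translation_def by blast
        then have "u = a * (y - x - v)"
          by (simp add: algebra_simps)
        then have "a dvd u"
          by (rule dvdI)
        then have "u + a * v = a * (u div a + v)"
          by (simp add: distrib_left)
        then have "translation (u div a + v) -` A \<in> p"
          using u(2) dilate inj_vimage_image_eq[OF inj_affine_semigroup[OF g]] by simp
        then show ?thesis
          using u(1) by blast
      qed
      have "finite ((\<lambda>u. u div a) ` F)"
        using F(1) by simp
      then show "syndetic {u. translation u -` A \<in> p}"
        by (rule syndeticI) (unfold mem_Collect_eq, rule cover)
    qed
  qed
qed

text \<open>The closure, in the space of ultrafilters concentrated at plus infinity, of the set of
  additively recurrent ones.\<close>

definition recurrent_closure :: "int set set set" where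
  "recurrent_closure = {p \<in> infinity_ultrafilters.
     \<forall>A\<in>p. \<exists>m\<in>infinity_ultrafilters. additively_recurrent m \<and> A \<in> m}"

lemma recurrent_closure_subset: "recurrent_closure \<subseteq> infinity_ultrafilters"
  unfolding recurrent_closure_def by (rule Collect_restrict)

lemma recurrent_closure_ultrafilters: "recurrent_closure \<subseteq> Collect is_ultrafilter"
  using recurrent_closure_subset infinity_ultrafiltersD(1) by blast

lemma closedin_infinity_ultrafilters: "closedin cantor_cube infinity_ultrafilters"
  unfolding infinity_ultrafilters_def by (rule closedin_ultrafilters)

lemma closedin_recurrent_closure: "closedin cantor_cube recurrent_closure"
proof -
  have sub: "infinity_ultrafilters \<subseteq> Collect is_ultrafilter"
    using infinity_ultrafiltersD(1) by blast
  have "openin (subtopology cantor_cube infinity_ultrafilters) (infinity_ultrafilters - recurrent_closure)"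
    unfolding openin_ultrafilter_space[OF sub] by (fastforce simp: recurrent_closure_def)
  then have "closedin (subtopology cantor_cube infinity_ultrafilters) recurrent_closure"
    by (auto simp: closedin_def recurrent_closure_def)
  then show ?thesis
    using closedin_infinity_ultrafilters by (rule closedin_trans_full)
qed

lemma push_recurrent_closure:
  assumes g: "g \<in> affine_semigroup"
  shows "push g ` recurrent_closure \<subseteq> recurrent_closure"
proof
  fix q assume "q \<in> push g ` recurrent_closure"
  then obtain p where p: "p \<in> recurrent_closure" "q = push g p"
    by blast
  have "\<exists>m\<in>infinity_ultrafilters. additively_recurrent m \<and> A \<in> m" if A: "A \<in> q" for A
  proof -
    obtain m where m: "m \<in> infinity_ultrafilters" "additively_recurrent m" "g -` A \<in> m"
      using p A by (auto simp: recurrent_closure_def)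
    then have "additively_recurrent (push g m)"
      using additively_recurrent_push_iff[OF g] infinity_ultrafiltersD(1) by blast
    then show ?thesis
      using m push_infinity_ultrafilters[OF g] by (intro bexI[of _ "push g m"]) auto
  qed
  then show "q \<in> recurrent_closure"
    using p push_infinity_ultrafilters[OF g] by (auto simp: recurrent_closure_def)
qed

text \<open>This is what makes \<open>push g\<close> open: recurrence passes not only to images but also back to
  preimages, so that every point of the space that contains \<open>range g\<close> is the image of a point of
  the space.\<close>

lemma recurrent_closure_eq_push:
  assumes g: "g \<in> affine_semigroup" and q: "q \<in> recurrent_closure" and A: "g ` A \<in> q"
  obtains p where "p \<in> recurrent_closure" "A \<in> p" "push g p = q"
proof -
  have qinf: "q \<in> infinity_ultrafilters"
    using q by (simp add: recurrent_closure_def)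
  obtain p where p: "p \<in> infinity_ultrafilters" "A \<in> p" "push g p = q"
    using infinity_ultrafilter_eq_push[OF g qinf A] by blast
  have "\<exists>m\<in>infinity_ultrafilters. additively_recurrent m \<and> B \<in> m" if B: "B \<in> p" for B
  proof -
    have "g ` B \<in> q"
      using B p(3) image_mem_push[OF inj_affine_semigroup[OF g]] by blast
    then obtain m where m: "m \<in> infinity_ultrafilters" "additively_recurrent m" "g ` B \<in> m"
      using q by (auto simp: recurrent_closure_def)
    obtain m' where m': "m' \<in> infinity_ultrafilters" "B \<in> m'" "push g m' = m"
      using infinity_ultrafilter_eq_push[OF g m(1,3)] by blast
    then have "additively_recurrent m'"
      using additively_recurrent_push_iff[OF g] infinity_ultrafiltersD(1) m(2) by blast
    then show ?thesis
      using m' by blast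
  qed
  then have "p \<in> recurrent_closure"
    using p(1) by (simp add: recurrent_closure_def)
  then show thesis
    using p(2,3) by (rule that)
qed

lemma open_map_push_recurrent_closure:
  assumes g: "g \<in> affine_semigroup"
  shows "open_map (subtopology cantor_cube recurrent_closure)
    (subtopology cantor_cube recurrent_closure) (push g)"
  unfolding open_map_def
proof (intro allI impI)
  fix V assume V: "openin (subtopology cantor_cube recurrent_closure) V"
  note top = openin_ultrafilter_space[OF recurrent_closure_ultrafilters]
  have V': "V \<subseteq> recurrent_closure" "\<forall>p\<in>V. \<exists>A\<in>p. {q \<in> recurrent_closure. A \<in> q} \<subseteq> V"
    using V unfolding top by (rule conjunct1, rule conjunct2)
  have "push g ` V \<subseteq> recurrent_closure"
    using image_mono[OF V'(1)] push_recurrent_closure[OF g] by (rule order_trans)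
  moreover have "\<exists>B\<in>q. {r \<in> recurrent_closure. B \<in> r} \<subseteq> push g ` V" if q: "q \<in> push g ` V" for q
  proof -
    obtain p where p: "q = push g p" "p \<in> V"
      using q by blast
    obtain A where A: "A \<in> p" "{r \<in> recurrent_closure. A \<in> r} \<subseteq> V"
      using bspec[OF V'(2) p(2)] by (rule bexE)
    have "{r \<in> recurrent_closure. g ` A \<in> r} \<subseteq> push g ` V"
    proof clarify
      fix r assume r: "r \<in> recurrent_closure" "g ` A \<in> r"
      obtain p' where p': "p' \<in> recurrent_closure" "A \<in> p'" "push g p' = r"
        using recurrent_closure_eq_push[OF g r] .
      then have "p' \<in> V"
        using A(2) by (simp add: subset_iff)
      then show "r \<in> push g ` V"
        unfolding p'(3)[symmetric] by (rule imageI)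
    qed
    moreover have "g ` A \<in> q"
      unfolding p(1) image_mem_push[OF inj_affine_semigroup[OF g]] by (rule A(1))
    ultimately show ?thesis
      by (rule bexI)
  qed
  ultimately show "openin (subtopology cantor_cube recurrent_closure) (push g ` V)"
    unfolding top by (intro conjI ballI)
qed

lemma ex_additively_recurrent: "\<exists>p\<in>infinity_ultrafilters. additively_recurrent p"
proof -
  have sys: "topological_system affine_semigroup (\<circ>) (subtopology cantor_cube infinity_ultrafilters) push"
    using closedin_infinity_ultrafilters infinity_ultrafilters_nonempty push_infinity_ultrafilters
    by (intro affine_system) auto
  obtain p where p: "minimal_point UNIV (+) (subtopology cantor_cube infinity_ultrafilters)
      (\<lambda>u. push (translation u)) p"
    using ex_minimal_point[OF translation_system[OF sys]] by blast
  then have "p \<in> infinity_ultrafilters"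
    by (simp add: minimal_point_def)
  then show ?thesis
    using additively_minimal_iff_recurrent[OF _ _ sys] p unfolding additively_minimal_def by blast
qed

lemma recurrent_in_recurrent_closure:
  "p \<in> infinity_ultrafilters \<Longrightarrow> additively_recurrent p \<Longrightarrow> p \<in> recurrent_closure"
  by (auto simp: recurrent_closure_def)

lemma recurrent_closure_system:
  "topological_system affine_semigroup (\<circ>) (subtopology cantor_cube recurrent_closure) push"
proof (rule affine_system)
  show "recurrent_closure \<noteq> {}"
    using ex_additively_recurrent recurrent_in_recurrent_closure by blast
qed (simp_all add: closedin_recurrent_closure push_recurrent_closure recurrent_closure_subset)

lemma dense_additively_minimal:
  "subtopology cantor_cube recurrent_closure closure_of
     {p \<in> recurrent_closure. additively_minimal (subtopology cantor_cube recurrent_closure) push p} =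
   recurrent_closure" (is "?X closure_of ?M = _")
proof -
  note sub = recurrent_closure_subset
  have M: "p \<in> ?M" if "p \<in> infinity_ultrafilters" "additively_recurrent p" for p
    using additively_minimal_iff_recurrent[OF sub _ recurrent_closure_system]
      recurrent_in_recurrent_closure[OF that] that(2) by blast
  have "p \<in> ?X closure_of ?M" if p: "p \<in> recurrent_closure" for p
    unfolding in_closure_of
  proof (intro conjI allI impI)
    fix V assume V: "p \<in> V \<and> openin ?X V"
    then obtain A where A: "A \<in> p" "{q \<in> recurrent_closure. A \<in> q} \<subseteq> V"
      unfolding openin_ultrafilter_space[OF recurrent_closure_ultrafilters] by blast
    obtain m where "m \<in> infinity_ultrafilters" "additively_recurrent m" "A \<in> m"
      using p A(1) by (auto simp: recurrent_closure_def)
    then show "\<exists>m. m \<in> ?M \<and> m \<in> V"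
      using M A(2) by blast
  qed (use p in simp)
  moreover have "?X closure_of ?M \<subseteq> recurrent_closure"
    using closure_of_subset_topspace[of ?X ?M] by simp
  ultimately show ?thesis
    by blast
qed

section \<open>Colorings\<close>

lemma coloring_open_cover:
  assumes "finite_coloring r C"
  shows "open_cover (subtopology cantor_cube recurrent_closure) r
    (\<lambda>t. {p \<in> recurrent_closure. C t \<in> p})"
proof -
  have "\<exists>t\<in>{1..r}. C t \<in> p" if p: "p \<in> recurrent_closure" for p
  proof -
    have pinf: "p \<in> infinity_ultrafilters"
      using p by (simp add: recurrent_closure_def)
    have "(\<Union>t\<in>{1..r}. C t) \<in> p"
      using assms infinity_ultrafiltersD(2)[OF pinf, of 1]
      by (simp add: finite_coloring_def pos_ints_def)
    then show ?thesis
      using ultrafilter_UN[OF infinity_ultrafiltersD(1)[OF pinf]] by blast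
  qed
  moreover have "openin (subtopology cantor_cube recurrent_closure) {p \<in> recurrent_closure. A \<in> p}" for A
    unfolding openin_ultrafilter_space[OF recurrent_closure_ultrafilters] by blast
  ultimately show ?thesis
    unfolding open_cover_def by auto
qed

text \<open>A common point of the sets \<open>push (g l) ` U\<close> is an ultrafilter that contains all the sets
  \<open>g l ` A\<close>, as well as the positive integers.\<close>

lemma Inter_images_nonempty:
  fixes g :: "nat \<Rightarrow> int \<Rightarrow> int"
  assumes k: "1 \<le> k" and g: "\<forall>l\<in>{1..k}. g l \<in> affine_semigroup"
    and ne: "(\<Inter>l\<in>{1..k}. push (g l) ` {p \<in> recurrent_closure. A \<in> p}) \<noteq> {}"
  shows "pos_ints \<inter> (\<Inter>l\<in>{1..k}. g l ` A) \<noteq> {}"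
proof -
  obtain q where "q \<in> (\<Inter>l\<in>{1..k}. push (g l) ` {p \<in> recurrent_closure. A \<in> p})"
    using ne unfolding ex_in_conv[symmetric] by (rule exE)
  then have q: "q \<in> push (g l) ` {p \<in> recurrent_closure. A \<in> p}" if "l \<in> {1..k}" for l
    using that by (rule INT_D)
  have "q \<in> recurrent_closure"
    using q[of 1] k g push_recurrent_closure[of "g 1"] by fastforce
  then have "q \<in> infinity_ultrafilters"
    by (simp add: recurrent_closure_def)
  note uq = infinity_ultrafiltersD[OF this]
  have "g l ` A \<in> q" if "l \<in> {1..k}" for l
    using q[OF that] image_mem_push[OF inj_affine_semigroup] g that by blast
  then have "(\<Inter>l\<in>{1..k}. g l ` A) \<in> q"
    by (simp add: ultrafilter_INT[OF uq(1)])
  then have "pos_ints \<inter> (\<Inter>l\<in>{1..k}. g l ` A) \<in> q"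
    using uq(2)[of 1] by (simp add: ultrafilter_Int[OF uq(1)] pos_ints_def)
  then show ?thesis
    using ultrafilter_empty[OF uq(1)] by metis
qed

theorem theorem3p2:
  shows "\<exists>(X :: point topology) (T :: (int \<Rightarrow> int) \<Rightarrow> point \<Rightarrow> point).
    topological_system affine_semigroup (\<circ>) X T \<and>
    X closure_of {x \<in> topspace X. additively_minimal X T x} = topspace X \<and>
    (\<forall>g\<in>affine_semigroup. open_map X X (T g) \<and> inj_on (T g) (topspace X)) \<and>
    (\<forall>(r :: nat) (C :: nat \<Rightarrow> int set). finite_coloring r C \<longrightarrow>
      (\<exists>U :: nat \<Rightarrow> point set. open_cover X r U \<and>
        (\<forall>(k :: nat) (g :: nat \<Rightarrow> int \<Rightarrow> int) (t :: nat).
          1 \<le> k \<longrightarrow> (\<forall>l\<in>{1..k}. g l \<in> affine_semigroup) \<longrightarrow> t \<in> {1..r} \<longrightarrow>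
          (\<Inter>l\<in>{1..k}. T (g l) ` U t) \<noteq> {} \<longrightarrow>
          pos_ints \<inter> (\<Inter>l\<in>{1..k}. g l ` C t) \<noteq> {})))"
proof (intro exI[of _ "subtopology cantor_cube recurrent_closure"] exI[of _ push] conjI ballI allI impI)
  let ?X = "subtopology cantor_cube recurrent_closure"
  show "topological_system affine_semigroup (\<circ>) ?X push"
    by (rule recurrent_closure_system)
  show "?X closure_of {x \<in> topspace ?X. additively_minimal ?X push x} = topspace ?X"
    using dense_additively_minimal by simp
  fix g assume g: "g \<in> affine_semigroup"
  show "open_map ?X ?X (push g)"
    using g by (rule open_map_push_recurrent_closure)
  show "inj_on (push g) (topspace ?X)"
    using inj_push[OF inj_affine_semigroup[OF g]] by (rule inj_on_subset) simp
next
  fix r and C :: "nat \<Rightarrow> int set"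
  assume "finite_coloring r C"
  then have "open_cover (subtopology cantor_cube recurrent_closure) r
      (\<lambda>t. {p \<in> recurrent_closure. C t \<in> p})"
    by (rule coloring_open_cover)
  then show "\<exists>U. open_cover (subtopology cantor_cube recurrent_closure) r U \<and>
    (\<forall>(k :: nat) g t. 1 \<le> k \<longrightarrow> (\<forall>l\<in>{1..k}. g l \<in> affine_semigroup) \<longrightarrow> t \<in> {1..r} \<longrightarrow>
      (\<Inter>l\<in>{1..k}. push (g l) ` U t) \<noteq> {} \<longrightarrow> pos_ints \<inter> (\<Inter>l\<in>{1..k}. g l ` C t) \<noteq> {})"
    by - (rule exI, rule conjI, assumption, intro allI impI, rule Inter_images_nonempty)
qed

end
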